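(* There exists a 2-colouring of the edges of $\vec{K}_{\mathbb{N}}$ (with colours red and blue) such that every monochromatic directed path in $\vec{K}_{\mathbb{N}}$ has upper density $0$.
   Context: $\mathbb{N}$ denotes the set of positive integers. $\vec{K}_{\mathbb{N}}$ is the complete symmetric digraph on $\mathbb{N}$: its vertex set is $\mathbb{N}$ and for every pair of distinct $m,n\in\mathbb{N}$ both directed edges $(m,n)$ (from $m$ to $n$) and $(n,m)$ are present. A $k$-colouring of $\vec{K}_{\mathbb{N}}$ is an assignment of one of $k$ colours to each directed edge (so $(m,n)$ and $(n,m)$ may receive different colours); in a 2-colouring the colours are red and blue. A path $P=v_1v_2\dots$ in $\vec{K}_{\mathbb{N}}$ is a finite or (one-way) infinite sequence of distinct vertices together with, for each pair of consecutive vertices, one of the two directed edges joining them. $P$ is a directed path if all its edges are oriented in the same direction along $P$. A path is monochromatic if all of its edges have the same colour. The upper density of a set $A\subseteq\mathbb{N}$ is $\bar d(A)=\limsup_{n\to\infty}\frac{|A\cap\{1,\dots,n\}|}{n}$, and the upper density of a path is the upper density of its vertex set. *)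

theory Defs
  imports "HOL-Library.Extended_Real" "Graph_Theory.Pair_Digraph"
begin

text \<open>The vertex set is the set of positive integers; 0 is not a vertex.\<close>

definition complete_sym_digraph_nat :: "nat pair_pre_digraph" where
  "complete_sym_digraph_nat =
     \<lparr> pverts = {1..}, parcs = {(m, n). m \<in> {1..} \<and> n \<in> {1..} \<and> m \<noteq> n} \<rparr>"

text \<open>
  A colouring is a total function on pairs of vertices; its values on pairs that are not
  arcs are never consulted.
\<close>

datatype colour = Red | Blue

type_synonym 'a two_colouring = "'a \<times> 'a \<Rightarrow> colour"

text \<open>
  A finite or one-way infinite path, with vertices indexed from 0. The first field is the number
  of vertices, infinite for an infinite path. Only the values \<open>vertex P i\<close> with
  \<open>enat i < vcount P\<close> and \<open>edge P i\<close> with \<open>enat (Suc i) < vcount P\<close>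
  matter; \<open>edge P i\<close> is the arc chosen between the vertices number \<open>i\<close> and
  \<open>Suc i\<close>, in either orientation.
\<close>

record 'a orpath =
  vcount :: enat
  vertex :: "nat \<Rightarrow> 'a"
  edge :: "nat \<Rightarrow> 'a \<times> 'a"

definition vertex_set :: "'a orpath \<Rightarrow> 'a set" where
  "vertex_set P = vertex P ` {i. enat i < vcount P}"

definition edge_set :: "'a orpath \<Rightarrow> ('a \<times> 'a) set" where
  "edge_set P = edge P ` {i. enat (Suc i) < vcount P}"

definition path_in :: "'a pair_pre_digraph \<Rightarrow> 'a orpath \<Rightarrow> bool" where
  "path_in G P \<longleftrightarrow>
     vcount P > 0 \<and>
     vertex_set P \<subseteq> pverts G \<and>
     edge_set P \<subseteq> parcs G \<and>
     inj_on (vertex P) {i. enat i < vcount P} \<and>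
     (\<forall>i. enat (Suc i) < vcount P \<longrightarrow>
        edge P i = (vertex P i, vertex P (Suc i)) \<or> edge P i = (vertex P (Suc i), vertex P i))"

text \<open>
  All edges point forward along the sequence, or all point backward; for an infinite path these
  two cases are genuinely different.
\<close>

definition directed_path_in :: "'a pair_pre_digraph \<Rightarrow> 'a orpath \<Rightarrow> bool" where
  "directed_path_in G P \<longleftrightarrow> path_in G P \<and>
     ((\<forall>i. enat (Suc i) < vcount P \<longrightarrow> edge P i = (vertex P i, vertex P (Suc i))) \<or>
      (\<forall>i. enat (Suc i) < vcount P \<longrightarrow> edge P i = (vertex P (Suc i), vertex P i)))"

definition monochromatic :: "'a two_colouring \<Rightarrow> 'a orpath \<Rightarrow> bool" where
  "monochromatic c P \<longleftrightarrow> (\<exists>r. \<forall>e \<in> edge_set P. c e = r)"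

definition upper_density :: "nat set \<Rightarrow> ereal" where
  "upper_density A = limsup (\<lambda>n. ereal (real (card (A \<inter> {1..n})) / real n))"

definition path_upper_density :: "nat orpath \<Rightarrow> ereal" where
  "path_upper_density P = upper_density (vertex_set P)"

end

theory Submission
  imports Defs
begin

text \<open>
  Compare positive integers by reading their binary digits from the least significant one upwards
  (the order of the van der Corput sequence), and colour \<open>(m, n)\<close> red if it ascends in this
  order and blue if it descends. Along a monochromatic directed path the order is then monotone.
  For fixed \<open>k\<close>, the last \<open>k\<close> digits split the order into \<open>2 ^ k\<close> consecutive intervals, and
  a monotone sequence must stay in one of them from some point on. But each such interval is a
  residue class modulo \<open>2 ^ k\<close>. So, up to finitely many exceptions, the vertices of the path lie
  in a set of density \<open>1 / 2 ^ k\<close> (\<open>eventually_const_bit_reversal\<close>), and since \<open>k\<close> is arbitrary the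
  density of the path is 0 (\<open>upper_density_zeroI\<close>).

  In other words, any equidistributed sequence \<open>x\<close> in the unit interval would give such a colouring
  by comparing \<open>x m\<close> with \<open>x n\<close>, because the values along a path are monotone, hence converge.
\<close>

text \<open>
  The last \<open>k\<close> binary digits in reversed order, that is, \<open>2 ^ k\<close> times the van der Corput number
  of \<open>n\<close>, rounded down. The truncations for all \<open>k\<close> together describe the order by natural numbers
  alone.
\<close>

fun bit_reversal :: "nat \<Rightarrow> nat \<Rightarrow> nat" where
  "bit_reversal 0 n = 0"
| "bit_reversal (Suc k) n = 2 * bit_reversal k n + n div 2 ^ k mod 2"

lemma bit_reversal_less: "bit_reversal k n < 2 ^ k"
proof (induction k)
  case (Suc k)
  have "n div 2 ^ k mod 2 < 2" by simp
  with Suc show ?case by simp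
qed simp

lemma bit_reversal_eq_imp_mod_eq:
  "bit_reversal k m = bit_reversal k n \<Longrightarrow> m mod 2 ^ k = n mod 2 ^ k"
proof (induction k)
  case (Suc k)
  have "bit_reversal k m = bit_reversal k n" "m div 2 ^ k mod 2 = n div 2 ^ k mod 2"
    using arg_cong[OF Suc.prems, of "\<lambda>x. x div 2"] arg_cong[OF Suc.prems, of "\<lambda>x. x mod 2"]
    by simp_all
  with Suc.IH show ?case
    by (simp add: mod_mult2_eq mult.commute[of 2])
qed simp

text \<open>The first digit in which two numbers differ decides; later digits cannot reverse it.\<close>

lemma bit_reversal_less_mono:
  assumes "bit_reversal j m < bit_reversal j n" "j \<le> k"
  shows "bit_reversal k m < bit_reversal k n"
  using assms(2)
proof (induction k rule: dec_induct)
  case (step k)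
  have "m div 2 ^ k mod 2 < 2" by simp
  with step.IH show ?case by simp
qed (rule assms(1))

lemma bit_reversal_less_imp_le:
  assumes "bit_reversal j m < bit_reversal j n"
  shows "bit_reversal k m \<le> bit_reversal k n"
  using assms bit_reversal_less_mono[of j m n k] bit_reversal_less_mono[of k n m j]
  by (metis linorder_le_cases not_less order.asym)

definition bit_reversal_colouring :: "nat two_colouring" where
  "bit_reversal_colouring = (\<lambda>(m, n).
     if \<exists>k. bit_reversal k m < bit_reversal k n then Red else Blue)"

lemma bit_reversal_colouring_Red:
  "bit_reversal_colouring (m, n) = Red \<Longrightarrow> bit_reversal k m \<le> bit_reversal k n"
  by (auto simp: bit_reversal_colouring_def bit_reversal_less_imp_le split: if_splits)

lemma bit_reversal_colouring_Blue:
  "bit_reversal_colouring (m, n) = Blue \<Longrightarrow> bit_reversal k n \<le> bit_reversal k m"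
  by (auto simp: bit_reversal_colouring_def not_less split: if_splits)

lemma finite_range_monotone_eventually_const:
  fixes f :: "nat \<Rightarrow> 'a::linorder"
  assumes fin: "finite (range f)" and mono: "incseq f \<or> decseq f"
  shows "\<exists>N. \<forall>i\<ge>N. f i = f N"
  using mono
proof
  assume "incseq f"
  obtain N where "f N = Max (range f)"
    using Max_in[OF fin] by fastforce
  then show ?thesis
    using \<open>incseq f\<close> fin by (metis Max_ge incseqD order.antisym rangeI)
next
  assume "decseq f"
  obtain N where "f N = Min (range f)"
    using Min_in[OF fin] by fastforce
  then show ?thesis
    using \<open>decseq f\<close> fin by (metis Min_le decseqD order.antisym rangeI)
qed

text \<open>
  Both ways to orient a path and both colours are possible, but each combination only decides
  whether the reversals increase or decrease along the sequence of vertices.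
\<close>

lemma eventually_const_bit_reversal:
  assumes path: "directed_path_in G P" and mono: "monochromatic bit_reversal_colouring P"
    and infinite: "vcount P = \<infinity>"
  shows "\<exists>N. \<forall>i\<ge>N. bit_reversal k (vertex P i) = bit_reversal k (vertex P N)"
proof (rule finite_range_monotone_eventually_const)
  show "finite (range (\<lambda>i. bit_reversal k (vertex P i)))"
    by (rule finite_subset[of _ "{..<2 ^ k}"]) (auto simp: bit_reversal_less)
next
  obtain r where r: "\<And>i. bit_reversal_colouring (edge P i) = r"
    using mono infinite by (auto simp: monochromatic_def edge_set_def)
  have "(\<forall>i. edge P i = (vertex P i, vertex P (Suc i))) \<or>
      (\<forall>i. edge P i = (vertex P (Suc i), vertex P i))"
    using path infinite by (simp add: directed_path_in_def)
  then show "incseq (\<lambda>i. bit_reversal k (vertex P i)) \<or> decseq (\<lambda>i. bit_reversal k (vertex P i))"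
    using r bit_reversal_colouring_Red bit_reversal_colouring_Blue
    unfolding incseq_Suc_iff decseq_Suc_iff by (cases r) auto
qed

lemma card_residue_class_le: "card ({n. n mod q = r} \<inter> {1..n}) \<le> n div q + 1" for q :: nat
proof -
  have "card ({n. n mod q = r} \<inter> {1..n}) \<le> card {..n div q}"
  proof (rule card_inj_on_le)
    show "inj_on (\<lambda>x. x div q) ({n. n mod q = r} \<inter> {1..n})"
    proof (rule inj_onI)
      fix x y
      assume "x \<in> {n. n mod q = r} \<inter> {1..n}" "y \<in> {n. n mod q = r} \<inter> {1..n}" "x div q = y div q"
      then show "x = y"
        using div_mult_mod_eq[of x q] div_mult_mod_eq[of y q] by simp
    qed
  qed (auto simp: div_le_mono)
  then show ?thesis by simp
qed

lemma upper_density_zeroI: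
  assumes "\<And>k. \<exists>F r. finite F \<and> A \<subseteq> F \<union> {n. n mod 2 ^ k = r}"
  shows "upper_density A = 0"
proof -
  have "(\<lambda>n. real (card (A \<inter> {1..n})) / real n) \<longlonglongrightarrow> 0"
  proof (rule LIMSEQ_I)
    fix e :: real assume "e > 0"
    obtain k where k: "1 / 2 ^ k < e / 2"
      using \<open>e > 0\<close> real_arch_pow_inv[of "e / 2" "1 / 2"] by (auto simp: power_one_over)
    obtain F r where F: "finite F" "A \<subseteq> F \<union> {n. n mod 2 ^ k = r}"
      using assms by blast
    obtain N :: nat where N: "2 * (real (card F) + 1) / e < N"
      using reals_Archimedean2 by blast
    have "real (card (A \<inter> {1..n})) / real n < e" if "n \<ge> max N 1" for n
    proof -
      have "card (A \<inter> {1..n}) \<le> card (F \<union> ({n. n mod 2 ^ k = r} \<inter> {1..n}))"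
        using F by (intro card_mono) auto
      also have "\<dots> \<le> card F + (n div 2 ^ k + 1)"
        using card_Un_le card_residue_class_le by (meson add_left_mono order.trans)
      finally have "real (card (A \<inter> {1..n})) \<le> real (card F) + 1 + real (n div 2 ^ k)"
        by linarith
      also have "real (n div 2 ^ k) \<le> real n * (1 / 2 ^ k)"
        using of_nat_mono[OF div_times_less_eq_dividend[of n "2 ^ k"], where ?'a = real]
        by (simp add: field_simps)
      also have "real n * (1 / 2 ^ k) < real n * (e / 2)"
        using k that by (intro mult_strict_left_mono) auto
      also have "real (card F) + 1 < real n * (e / 2)"
      proof -
        have "2 * (real (card F) + 1) / e < real n" using N that by linarith
        then show ?thesis using \<open>e > 0\<close> by (simp add: field_simps)
      qed
      finally show ?thesis using that by (simp add: field_simps)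
    qed
    then show "\<exists>N. \<forall>n\<ge>N. norm (real (card (A \<inter> {1..n})) / real n - 0) < e"
      by (intro exI[of _ "max N 1"]) simp
  qed
  then have "(\<lambda>n. ereal (real (card (A \<inter> {1..n})) / real n)) \<longlonglongrightarrow> 0"
    by (simp add: zero_ereal_def)
  then show ?thesis
    unfolding upper_density_def by (simp add: lim_imp_Limsup)
qed

theorem theorem1p2:
  shows "\<exists>c :: nat two_colouring.
    \<forall>P. directed_path_in complete_sym_digraph_nat P \<and> monochromatic c P \<longrightarrow>
      path_upper_density P = 0"
proof (intro exI[of _ bit_reversal_colouring] allI impI, elim conjE)
  fix P
  assume P: "directed_path_in complete_sym_digraph_nat P" "monochromatic bit_reversal_colouring P"
  have "\<exists>F r. finite F \<and> vertex_set P \<subseteq> F \<union> {n. n mod 2 ^ k = r}" for k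
  proof (cases "vcount P")
    case (enat l)
    then have "finite (vertex_set P)"
      by (simp add: vertex_set_def)
    then show ?thesis by blast
  next
    case infinity
    then obtain N where "\<forall>i\<ge>N. bit_reversal k (vertex P i) = bit_reversal k (vertex P N)"
      using eventually_const_bit_reversal P by blast
    then have "\<forall>i\<ge>N. vertex P i mod 2 ^ k = vertex P N mod 2 ^ k"
      using bit_reversal_eq_imp_mod_eq by blast
    then have "vertex_set P \<subseteq> vertex P ` {..<N} \<union> {n. n mod 2 ^ k = vertex P N mod 2 ^ k}"
      unfolding vertex_set_def by (blast intro: leI)
    then show ?thesis by blast
  qed
  then show "path_upper_density P = 0"
    unfolding path_upper_density_def by (rule upper_density_zeroI)
qed

end
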